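(* Let $X$ be a nonempty set, let $(E,\tau,\preceq_C)$ be an ordered topological vector space with a solid cone $C$, and let $d:X\times X\to E$ be a cone metric on $X$. If $e\in\operatorname{int} C$ is arbitrary, then $D(x,y)=\|d(x,y)\|_e$ is a (standard, real-valued) metric on $X$. Moreover, a sequence $\{x_n\}$ in $X$ is Cauchy in $(X,d)$ if and only if it is Cauchy in $(X,D)$, and it is convergent in $(X,d)$ if and only if it is convergent in $(X,D)$.
   Context: $E$ is a real vector space with zero vector $\theta$ and a vector topology $\tau$. A cone $C\subset E$ is a set such that: (1) $C$ is closed, nonempty and $C\neq\{\theta\}$; (2) $x,y\in C$, $\lambda,\mu\ge0$ imply $\lambda x+\mu y\in C$; (3) $C\cap(-C)=\{\theta\}$. It induces the partial order $x\preceq_C y\iff y-x\in C$ (also written $\preceq$), and $(E,\tau,\preceq_C)$ is called an ordered topological vector space. $C$ is solid if $\operatorname{int} C\neq\emptyset$; write $x\ll y$ iff $y-x\in\operatorname{int} C$. For $e\in\operatorname{int} C$, $[-e,e]=\{z\in E\mid -e\preceq z\preceq e\}$ and $\|x\|_e=\inf\{\lambda>0\mid x\in\lambda[-e,e]\}$ is its Minkowski functional, which is a norm on $E$. A cone metric on $X$ is a map $d:X\times X\to E$ such that for all $x,y,z\in X$: (i) $d(x,y)\succeq\theta$, and $d(x,y)=\theta$ iff $x=y$; (ii) $d(x,y)=d(y,x)$; (iii) $d(x,z)\preceq d(x,y)+d(y,z)$. A sequence $\{x_n\}$ in $X$ converges to $x\in X$ in $(X,d)$ if for each $c\in\operatorname{int}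 C$ there is $n_0\in\mathbb{N}$ such that $d(x_n,x)\ll c$ for all $n\ge n_0$; it is Cauchy in $(X,d)$ if for each $c\in\operatorname{int} C$ there is $n_0\in\mathbb{N}$ such that $d(x_m,x_n)\ll c$ for all $m,n\ge n_0$. *)

theory Defs
  imports "HOL-Analysis.Analysis"
begin

(* Real vector spaces with a vector topology, not assumed Hausdorff.  Continuity of negation,
   part of topological_ab_group_add, already follows from continuity of scalar multiplication. *)
class real_topological_vector = real_vector + topological_ab_group_add +
  assumes tendsto_scaleR_Pair: "LIM p (nhds a \<times>\<^sub>F nhds x). fst p *\<^sub>R snd p :> nhds (a *\<^sub>R x)"

instance real_normed_vector \<subseteq> real_topological_vector
proof
  fix a :: real and x :: 'a
  show "LIM p (nhds a \<times>\<^sub>F nhds x). fst p *\<^sub>R snd p :> nhds (a *\<^sub>R x)"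
    by (intro tendsto_scaleR filterlim_fst filterlim_snd)
qed

(* Not to be confused with the library constants cone and convex_cone, which require neither
   closedness nor that the cone be pointed. *)
definition ordering_cone :: "'e::real_topological_vector set \<Rightarrow> bool" where
  "ordering_cone C \<longleftrightarrow>
     closed C \<and> C \<noteq> {} \<and> C \<noteq> {0} \<and>
     (\<forall>x\<in>C. \<forall>y\<in>C. \<forall>a\<ge>0. \<forall>b\<ge>0. a *\<^sub>R x + b *\<^sub>R y \<in> C) \<and>
     C \<inter> uminus ` C = {0}"

definition solid :: "'e::topological_space set \<Rightarrow> bool" where
  "solid C \<longleftrightarrow> interior C \<noteq> {}"

definition cone_le :: "'e::real_topological_vector set \<Rightarrow> 'e \<Rightarrow> 'e \<Rightarrow> bool" where
  "cone_le C x y \<longleftrightarrow> y - x \<in> C"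

definition cone_ll :: "'e::real_topological_vector set \<Rightarrow> 'e \<Rightarrow> 'e \<Rightarrow> bool" where
  "cone_ll C x y \<longleftrightarrow> y - x \<in> interior C"

definition cone_interval :: "'e::real_topological_vector set \<Rightarrow> 'e \<Rightarrow> 'e \<Rightarrow> 'e set" where
  "cone_interval C a b = {z. cone_le C a z \<and> cone_le C z b}"

definition cone_norm :: "'e::real_topological_vector set \<Rightarrow> 'e \<Rightarrow> 'e \<Rightarrow> real" where
  "cone_norm C e x = Inf {r. r > 0 \<and> x \<in> (\<lambda>z. r *\<^sub>R z) ` cone_interval C (- e) e}"

definition cone_metric ::
    "'a set \<Rightarrow> 'e::real_topological_vector set \<Rightarrow> ('a \<Rightarrow> 'a \<Rightarrow> 'e) \<Rightarrow> bool" where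
  "cone_metric X C d \<longleftrightarrow>
     (\<forall>x\<in>X. \<forall>y\<in>X. cone_le C 0 (d x y) \<and> (d x y = 0 \<longleftrightarrow> x = y)) \<and>
     (\<forall>x\<in>X. \<forall>y\<in>X. d x y = d y x) \<and>
     (\<forall>x\<in>X. \<forall>y\<in>X. \<forall>z\<in>X. cone_le C (d x z) (d x y + d y z))"

definition cone_converges_to ::
    "'e::real_topological_vector set \<Rightarrow> ('a \<Rightarrow> 'a \<Rightarrow> 'e) \<Rightarrow> (nat \<Rightarrow> 'a) \<Rightarrow> 'a \<Rightarrow> bool" where
  "cone_converges_to C d s l \<longleftrightarrow>
     (\<forall>c\<in>interior C. \<exists>n0. \<forall>n\<ge>n0. cone_ll C (d (s n) l) c)"

definition cone_Cauchy ::
    "'e::real_topological_vector set \<Rightarrow> ('a \<Rightarrow> 'a \<Rightarrow> 'e) \<Rightarrow> (nat \<Rightarrow> 'a) \<Rightarrow> bool" where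
  "cone_Cauchy C d s \<longleftrightarrow>
     (\<forall>c\<in>interior C. \<exists>n0. \<forall>m\<ge>n0. \<forall>n\<ge>n0. cone_ll C (d (s m) (s n)) c)"

(* The value 0 off X \<times> X is immaterial; it is there because the locale Metric_space demands
   nonnegativity and symmetry on the whole type, while d is arbitrary outside X. *)
definition scalar_metric ::
    "'a set \<Rightarrow> 'e::real_topological_vector set \<Rightarrow> 'e \<Rightarrow> ('a \<Rightarrow> 'a \<Rightarrow> 'e) \<Rightarrow> 'a \<Rightarrow> 'a \<Rightarrow> real" where
  "scalar_metric X C e d x y = (if x \<in> X \<and> y \<in> X then cone_norm C e (d x y) else 0)"

end

theory Submission
  imports Defs
begin

text \<open>
  For \<open>x \<in> C\<close> the Minkowski functional of \<open>[-e, e]\<close> is controlled by order relations with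
  multiples of \<open>e\<close>: since \<open>C\<close> is closed, \<open>\<parallel>x\<parallel> \<le> r\<close> iff \<open>x \<preceq> r e\<close> for \<open>r \<ge> 0\<close>, and
  \<open>\<parallel>x\<parallel> < r\<close> iff \<open>x \<lless> r e\<close> for \<open>r > 0\<close>. The first equivalence turns the cone metric axioms into
  those of a metric. The second one identifies the two notions of smallness, because every
  \<open>c \<in> int C\<close> dominates some \<open>r e\<close> with \<open>r > 0\<close>.
\<close>

section \<open>Continuity along lines and scalings in a topological vector space\<close>

lemma continuous_on_scaleR_right_tvs:
  fixes r :: real
  shows "continuous_on A (\<lambda>x::'e::real_topological_vector. r *\<^sub>R x)"
  unfolding continuous_on_def
proof
  fix x :: 'e
  have "filterlim (\<lambda>y. (r, y)) (nhds r \<times>\<^sub>F nhds x) (at x within A)"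
    by (intro filterlim_Pair tendsto_const tendsto_ident_at)
  from filterlim_compose[OF tendsto_scaleR_Pair this]
  show "((\<lambda>y. r *\<^sub>R y) \<longlongrightarrow> r *\<^sub>R x) (at x within A)" by simp
qed

lemma tendsto_add_scaleR_tvs:
  fixes x y :: "'e::real_topological_vector"
  shows "((\<lambda>t. x + t *\<^sub>R y) \<longlongrightarrow> x + a *\<^sub>R y) (at a within A)"
proof -
  have "filterlim (\<lambda>t. (t, y)) (nhds a \<times>\<^sub>F nhds y) (at a within A)"
    by (intro filterlim_Pair tendsto_const tendsto_ident_at)
  from filterlim_compose[OF tendsto_scaleR_Pair this]
  show ?thesis by (intro tendsto_add tendsto_const) simp
qed

text \<open>The curve \<open>t \<mapsto> x + t *\<^sub>R y\<close> is continuous at 0, so it stays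
  in the open set \<open>interior A\<close> for small positive \<open>t\<close>.\<close>

lemma interior_add_small:
  fixes x y :: "'e::real_topological_vector"
  assumes "x \<in> interior A"
  obtains t where "0 < t" "x + t *\<^sub>R y \<in> A"
proof -
  have "((\<lambda>t. x + t *\<^sub>R y) \<longlongrightarrow> x) (at_right 0)"
    using tendsto_add_scaleR_tvs[of x y 0 "{0<..}"] by simp
  then have "\<forall>\<^sub>F t in at_right 0. x + t *\<^sub>R y \<in> interior A"
    using assms by (intro topological_tendstoD) auto
  then have "\<forall>\<^sub>F t::real in at_right 0. 0 < t \<and> x + t *\<^sub>R y \<in> interior A"
    by (intro eventually_conj eventually_at_right_less)
  then obtain t where "0 < t" "x + t *\<^sub>R y \<in> interior A"
    using eventually_happens'[OF trivial_limit_at_right_real] by blast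
  then show ?thesis using that interior_subset by blast
qed

section \<open>Algebra of the cone and of its interior\<close>

locale unit_cone =
  fixes C :: "'e::real_topological_vector set" and e :: 'e
  assumes cone: "ordering_cone C" and unit: "e \<in> interior C"
begin

lemma combination_mem:
  "x \<in> C \<Longrightarrow> y \<in> C \<Longrightarrow> 0 \<le> a \<Longrightarrow> 0 \<le> b \<Longrightarrow> a *\<^sub>R x + b *\<^sub>R y \<in> C"
  using cone by (simp add: ordering_cone_def)

lemma add_mem: "x \<in> C \<Longrightarrow> y \<in> C \<Longrightarrow> x + y \<in> C"
  using combination_mem[of x y 1 1] by simp

lemma scaleR_mem: "x \<in> C \<Longrightarrow> 0 \<le> r \<Longrightarrow> r *\<^sub>R x \<in> C"
  using combination_mem[of x x r 0] by simp

lemma zero_mem: "0 \<in> C"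
proof -
  have "0 \<in> C \<inter> uminus ` C" using cone by (simp add: ordering_cone_def)
  then show ?thesis by blast
qed

lemma unit_mem: "e \<in> C"
  using unit interior_subset by blast

lemma antisym_cone:
  assumes "x \<in> C" "- x \<in> C"
  shows "x = 0"
proof -
  have "C \<inter> uminus ` C = {0}" using cone by (simp add: ordering_cone_def)
  moreover have "x \<in> C \<inter> uminus ` C"
    using assms image_eqI[of x uminus "- x" C] by simp
  ultimately show ?thesis by simp
qed

text \<open>The translate of \<open>interior C\<close> by \<open>y\<close> is open, and it lies in
  \<open>C\<close> because \<open>C\<close> is closed under addition.\<close>

lemma interior_add_mem:
  assumes "x \<in> interior C" "y \<in> C"
  shows "x + y \<in> interior C"
proof (rule interiorI)
  show "open ((\<lambda>z. z - y) -` interior C)"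
    by (intro open_vimage open_interior continuous_intros)
  show "(\<lambda>z. z - y) -` interior C \<subseteq> C"
    using add_mem[OF _ assms(2)] interior_subset[of C] by fastforce
qed (use assms in simp)

lemma scaleR_interior:
  assumes "x \<in> interior C" "0 < r"
  shows "r *\<^sub>R x \<in> interior C"
proof (rule interiorI)
  show "open ((\<lambda>z. (1/r) *\<^sub>R z) -` interior C)"
    by (intro open_vimage open_interior continuous_on_scaleR_right_tvs)
  show "(\<lambda>z. (1/r) *\<^sub>R z) -` interior C \<subseteq> C"
  proof
    fix z assume "z \<in> (\<lambda>z. (1/r) *\<^sub>R z) -` interior C"
    then have "(1/r) *\<^sub>R z \<in> C" using interior_subset[of C] by auto
    from scaleR_mem[OF this, of r] show "z \<in> C" using assms by simp
  qed
qed (use assms in simp)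

lemma interior_dominates_unit:
  assumes "c \<in> interior C"
  obtains r where "0 < r" "c - r *\<^sub>R e \<in> C"
  using interior_add_small[OF assms, of "- e"] by auto

section \<open>The Minkowski functional on the cone\<close>

lemma scaleR_interval_iff:
  assumes "0 < r"
  shows "x \<in> (\<lambda>z. r *\<^sub>R z) ` cone_interval C (- e) e \<longleftrightarrow> r *\<^sub>R e + x \<in> C \<and> r *\<^sub>R e - x \<in> C"
    (is "?L \<longleftrightarrow> ?R")
proof
  assume ?L
  then obtain z where "x = r *\<^sub>R z" "z + e \<in> C" "e - z \<in> C"
    by (auto simp: cone_interval_def cone_le_def)
  then show ?R
    using scaleR_mem[of "z + e" r] scaleR_mem[of "e - z" r] assms by (simp add: algebra_simps)
next
  assume ?R
  then have "(1/r) *\<^sub>R (r *\<^sub>R e + x) \<in> C" "(1/r) *\<^sub>R (r *\<^sub>R e - x) \<in> C"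
    using assms by (auto intro!: scaleR_mem)
  then have "(1/r) *\<^sub>R x \<in> cone_interval C (- e) e"
    using assms by (simp add: cone_interval_def cone_le_def algebra_simps)
  moreover have "x = r *\<^sub>R ((1/r) *\<^sub>R x)" using assms by simp
  ultimately show ?L by blast
qed

text \<open>On the cone the lower bound by \<open>- r *\<^sub>R e\<close> is automatic, so only the
  upper bound constrains \<open>r\<close>.\<close>

lemma cone_norm_eq:
  assumes "x \<in> C"
  shows "cone_norm C e x = Inf {r. 0 < r \<and> r *\<^sub>R e - x \<in> C}"
proof -
  have "r *\<^sub>R e + x \<in> C" if "0 < r" for r
    using add_mem scaleR_mem unit_mem assms that by simp
  then have "{r. r > 0 \<and> x \<in> (\<lambda>z. r *\<^sub>R z) ` cone_interval C (- e) e}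
      = {r. 0 < r \<and> r *\<^sub>R e - x \<in> C}"
    using scaleR_interval_iff by blast
  then show ?thesis by (simp add: cone_norm_def)
qed

text \<open>Since \<open>e\<close> is interior, \<open>e - t *\<^sub>R x\<close> stays in
  \<open>C\<close> for some \<open>t > 0\<close>; dividing by \<open>t\<close> gives the claim. This
  keeps the sets under \<open>Inf\<close> nonempty.\<close>

lemma absorbing:
  obtains r where "0 < r" "r *\<^sub>R e - x \<in> C"
proof -
  obtain t where t: "0 < t" "e + t *\<^sub>R (- x) \<in> C"
    using interior_add_small[OF unit] by blast
  from scaleR_mem[OF this(2), of "1/t"] have "(1/t) *\<^sub>R e - x \<in> C"
    using t(1) by (simp add: algebra_simps)
  then show ?thesis using that[of "1/t"] t(1) by simp
qed

lemma cone_norm_nonneg: "x \<in> C \<Longrightarrow> 0 \<le> cone_norm C e x"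
  unfolding cone_norm_eq using absorbing[of x] by (intro cInf_greatest) auto

text \<open>Some admissible \<open>s\<close> lies below \<open>r\<close>, and the surplus
  \<open>(r - s) *\<^sub>R e\<close> is interior; adding the cone element
  \<open>s *\<^sub>R e - x\<close> keeps it so.\<close>

lemma cone_norm_lessD:
  assumes "x \<in> C" "cone_norm C e x < r"
  shows "r *\<^sub>R e - x \<in> interior C"
proof -
  have "{r. 0 < r \<and> r *\<^sub>R e - x \<in> C} \<noteq> {}" using absorbing[of x] by auto
  from cInf_lessD[OF this] assms obtain s where s: "s *\<^sub>R e - x \<in> C" "s < r"
    by (auto simp: cone_norm_eq)
  have "(r - s) *\<^sub>R e + (s *\<^sub>R e - x) \<in> interior C"
    using s unit by (intro interior_add_mem scaleR_interior) auto
  then show ?thesis by (simp add: algebra_simps)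
qed

lemma cone_norm_le_iff:
  assumes "x \<in> C" "0 \<le> r"
  shows "cone_norm C e x \<le> r \<longleftrightarrow> r *\<^sub>R e - x \<in> C"
proof
  assume le: "cone_norm C e x \<le> r"
  \<comment> \<open>Let \<open>s\<close> decrease to \<open>r\<close>: closedness of
    \<open>C\<close> carries membership over to the limit.\<close>
  have "\<forall>\<^sub>F s in at_right r. - x + s *\<^sub>R e \<in> C"
    using eventually_at_right_less[of r]
  proof eventually_elim
    case (elim s)
    then have "s *\<^sub>R e - x \<in> interior C" using le by (intro cone_norm_lessD assms) auto
    then show ?case using interior_subset[of C] by auto
  qed
  moreover have "closed C" using cone by (simp add: ordering_cone_def)
  ultimately have "- x + r *\<^sub>R e \<in> C"
    by (intro Lim_in_closed_set[OF _ _ trivial_limit_at_right_real tendsto_add_scaleR_tvs])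
  then show "r *\<^sub>R e - x \<in> C" by simp
next
  assume mem: "r *\<^sub>R e - x \<in> C"
  show "cone_norm C e x \<le> r"
  \<comment> \<open>The case \<open>r = 0\<close> is allowed, but the infimum ranges over positive
    numbers only; \<open>r + \<epsilon>\<close> is always admissible.\<close>
  proof (rule field_le_epsilon)
    fix \<epsilon> :: real assume "0 < \<epsilon>"
    then have "(r *\<^sub>R e - x) + \<epsilon> *\<^sub>R e \<in> C"
      using mem unit_mem by (intro add_mem scaleR_mem) auto
    then have "(r + \<epsilon>) *\<^sub>R e - x \<in> C" by (simp add: algebra_simps)
    then show "cone_norm C e x \<le> r + \<epsilon>"
      unfolding cone_norm_eq[OF assms(1)] using \<open>0 < \<epsilon>\<close> assms(2)
      by (intro cInf_lower bdd_belowI[of _ 0]) auto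
  qed
qed

lemma cone_norm_less_iff:
  assumes "x \<in> C" "0 < r"
  shows "cone_norm C e x < r \<longleftrightarrow> r *\<^sub>R e - x \<in> interior C"
proof
  assume int: "r *\<^sub>R e - x \<in> interior C"
  from interior_dominates_unit[OF this] obtain t
    where t: "0 < t" "r *\<^sub>R e - x - t *\<^sub>R e \<in> C" .
  \<comment> \<open>Capping at \<open>r\<close> keeps \<open>r - s\<close> nonnegative, as
    \<open>cone_norm_le_iff\<close> demands.\<close>
  define s where "s = min t r"
  have "(r *\<^sub>R e - x - t *\<^sub>R e) + (t - s) *\<^sub>R e \<in> C"
    using t unit_mem by (intro add_mem scaleR_mem) (auto simp: s_def)
  then have "(r - s) *\<^sub>R e - x \<in> C" by (simp add: algebra_simps)
  then have "cone_norm C e x \<le> r - s"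
    using assms by (subst cone_norm_le_iff) (auto simp: s_def)
  moreover have "0 < s" using t assms by (simp add: s_def)
  ultimately show "cone_norm C e x < r" by simp
qed (rule cone_norm_lessD[OF assms(1)])

text \<open>At \<open>r = 0\<close>, \<open>cone_norm_le_iff\<close> yields
  \<open>- x \<in> C\<close>, and pointedness of the cone forces \<open>x = 0\<close>.\<close>

lemma cone_norm_eq_0_iff:
  assumes "x \<in> C"
  shows "cone_norm C e x = 0 \<longleftrightarrow> x = 0"
  using cone_norm_le_iff[OF assms, of 0] cone_norm_nonneg[OF assms] antisym_cone[OF assms] zero_mem
  by auto

lemma cone_norm_triangle:
  assumes "x \<in> C" "y \<in> C" "z \<in> C" "cone_le C z (x + y)"
  shows "cone_norm C e z \<le> cone_norm C e x + cone_norm C e y"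
proof -
  let ?a = "cone_norm C e x" and ?b = "cone_norm C e y"
  \<comment> \<open>The bound \<open>cone_norm_le_iff\<close> may be used at the norms themselves,
    so no \<epsilon> is needed; \<open>x\<close> and \<open>y\<close> cancel in the sum.\<close>
  have "(?a *\<^sub>R e - x) + (?b *\<^sub>R e - y) + (x + y - z) \<in> C"
    using assms cone_norm_le_iff[of x ?a] cone_norm_le_iff[of y ?b]
    by (intro add_mem) (auto simp: cone_norm_nonneg cone_le_def)
  then have "(?a + ?b) *\<^sub>R e - z \<in> C" by (simp add: algebra_simps)
  then show ?thesis using assms cone_norm_nonneg by (subst cone_norm_le_iff) auto
qed

text \<open>The index sets \<open>A n\<close> are the tails of \<open>\<nat>\<close> for convergence, and of \<open>\<nat> \<times> \<nat>\<close> for the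
  Cauchy property.\<close>

lemma cone_small_iff_norm_small:
  assumes "\<And>i. f i \<in> C"
  shows "(\<forall>c\<in>interior C. \<exists>n. \<forall>i\<in>A n. cone_ll C (f i) c) \<longleftrightarrow>
    (\<forall>\<epsilon>>0. \<exists>n. \<forall>i\<in>A n. cone_norm C e (f i) < \<epsilon>)" (is "?L \<longleftrightarrow> ?R")
proof
  assume ?L
  show ?R
  proof (intro allI impI)
    fix \<epsilon> :: real assume "0 < \<epsilon>"
    then have "\<exists>n. \<forall>i\<in>A n. cone_ll C (f i) (\<epsilon> *\<^sub>R e)"
      using \<open>?L\<close> scaleR_interior[OF unit] by blast
    then show "\<exists>n. \<forall>i\<in>A n. cone_norm C e (f i) < \<epsilon>"
      using \<open>0 < \<epsilon>\<close> assms by (simp add: cone_ll_def cone_norm_less_iff)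
  qed
next
  assume ?R
  show ?L
  proof
    fix c assume "c \<in> interior C"
    from interior_dominates_unit[OF this] obtain r where r: "0 < r" "c - r *\<^sub>R e \<in> C" .
    \<comment> \<open>Split \<open>c - f i\<close> as
      \<open>(r *\<^sub>R e - f i) + (c - r *\<^sub>R e)\<close>, an interior point plus a cone
      element.\<close>
    have "cone_ll C (f i) c" if "cone_norm C e (f i) < r" for i
      using interior_add_mem[OF cone_norm_lessD[OF assms that] r(2)] by (simp add: cone_ll_def)
    with \<open>?R\<close> r(1) show "\<exists>n. \<forall>i\<in>A n. cone_ll C (f i) c" by meson
  qed
qed

section \<open>Metric axioms and comparison of sequences\<close>

lemma Metric_space_scalar_metric:
  assumes "cone_metric X C d"
  shows "Metric_space X (scalar_metric X C e d)"
proof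
  have mem: "d x y \<in> C" if "x \<in> X" "y \<in> X" for x y
    using assms that by (auto simp: cone_metric_def cone_le_def)
  fix x y
  show "0 \<le> scalar_metric X C e d x y"
    by (simp add: scalar_metric_def cone_norm_nonneg mem)
  show "scalar_metric X C e d x y = scalar_metric X C e d y x"
    using assms by (auto simp: scalar_metric_def cone_metric_def)
  assume xy: "x \<in> X" "y \<in> X"
  then show "scalar_metric X C e d x y = 0 \<longleftrightarrow> x = y"
    using assms by (simp add: scalar_metric_def cone_norm_eq_0_iff mem cone_metric_def)
  fix z assume "z \<in> X"
  with xy show "scalar_metric X C e d x z \<le> scalar_metric X C e d x y + scalar_metric X C e d y z"
    using assms by (auto simp: scalar_metric_def cone_metric_def mem intro!: cone_norm_triangle)
qed

lemma cone_Cauchy_iff_MCauchy: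
  assumes "cone_metric X C d" "range s \<subseteq> X"
  shows "cone_Cauchy C d s \<longleftrightarrow> Metric_space.MCauchy X (scalar_metric X C e d) s"
proof -
  interpret Metric_space X "scalar_metric X C e d"
    by (rule Metric_space_scalar_metric[OF assms(1)])
  have s: "s n \<in> X" for n using assms(2) by blast
  have "d (s m) (s n) \<in> C" for m n
    using assms(1) s by (auto simp: cone_metric_def cone_le_def)
  then show ?thesis
    using cone_small_iff_norm_small[of "\<lambda>p. d (s (fst p)) (s (snd p))" "\<lambda>n. {n..} \<times> {n..}"]
      assms(2) s
    by (simp add: cone_Cauchy_def MCauchy_def scalar_metric_def Ball_def imp_conjL)
qed

lemma cone_converges_to_iff_limitin:
  assumes "cone_metric X C d" "range s \<subseteq> X" "l \<in> X"
  shows "cone_converges_to C d s l \<longleftrightarrow>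
    limitin (Metric_space.mtopology X (scalar_metric X C e d)) s l sequentially"
proof -
  interpret Metric_space X "scalar_metric X C e d"
    by (rule Metric_space_scalar_metric[OF assms(1)])
  have s: "s n \<in> X" for n using assms(2) by blast
  have "d (s n) l \<in> C" for n
    using assms(1,3) s by (auto simp: cone_metric_def cone_le_def)
  from cone_small_iff_norm_small[OF this, of "\<lambda>n. {n..}"] show ?thesis
    using assms(3) s
    by (simp add: cone_converges_to_def limitin_metric eventually_sequentially scalar_metric_def
        Ball_def)
qed

end

theorem proposition3p1:
  fixes X :: "'a set"
    and C :: "'e::real_topological_vector set"
    and d :: "'a \<Rightarrow> 'a \<Rightarrow> 'e"
    and e :: 'e
  assumes "X \<noteq> {}"
    and "ordering_cone C"
    and "solid C"
    and "cone_metric X C d"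
    and "e \<in> interior C"
  defines "D \<equiv> scalar_metric X C e d"
  shows "Metric_space X D \<and>
    (\<forall>s. range s \<subseteq> X \<longrightarrow>
      (cone_Cauchy C d s \<longleftrightarrow> Metric_space.MCauchy X D s) \<and>
      ((\<exists>l\<in>X. cone_converges_to C d s l) \<longleftrightarrow>
       (\<exists>l\<in>X. limitin (Metric_space.mtopology X D) s l sequentially)))"
proof -
  interpret unit_cone C e
    using assms(2,5) by unfold_locales
  show ?thesis
    \<comment> \<open>Convergence agrees for each fixed limit in \<open>X\<close>, hence so do the
      two existence statements.\<close>
    unfolding D_def
    by (intro conjI allI impI bex_cong refl Metric_space_scalar_metric cone_Cauchy_iff_MCauchy
        cone_converges_to_iff_limitin assms(4))
qed

end
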